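(* Let $M\subset\mathbb{S}^n_+$ be nonempty, convex and compact, and let $\Omega_M:\mathbb{R}^{n\times m}\to\mathbb{R}\cup\{+\infty\}$, $\Omega_M(X)=\frac12\sigma_M(XX^T)$, be the associated variational Gram function. Then the conjugate $\Omega_M^*$ is finite-valued and given by $$\Omega_M^*(X)=\frac12\min_{V\in M}\{\mathrm{tr}(X^TV^\dagger X) : \mathrm{rge}\,X\subset\mathrm{rge}\,V\}.$$
   Context: $\mathbb{S}^n$ is the space of real symmetric $n\times n$ matrices with inner product $\langle X,Y\rangle=\mathrm{tr}(XY)$, and $\mathbb{S}^n_+$ is the set of positive semidefinite matrices in $\mathbb{S}^n$. $\sigma_M(U)=\sup_{V\in M}\mathrm{tr}(VU)$ is the support function of $M$. $\mathbb{R}^{n\times m}$ carries the inner product $\langle X,Y\rangle=\mathrm{tr}(X^TY)$, and the Fenchel conjugate of a function $f$ is $f^*(Y)=\sup_X\{\langle X,Y\rangle-f(X)\}$. $V^\dagger$ is the Moore–Penrose pseudoinverse of $V$ and $\mathrm{rge}$ denotes the range (column space) of a matrix.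
   Formalization: The claim that the conjugate is finite-valued fails for M={0}; it is replaced by: finite at X exactly when some V in M has rge X ⊂ rge V (otherwise +∞, the minimum over the empty set), and finite everywhere exactly when M contains an invertible matrix. *)

theory Defs
  imports "HOL-Analysis.Analysis"
begin

text \<open>
  The type \<open>real^'m^'n\<close> consists of matrices with rows indexed by \<open>'n\<close> and columns indexed
  by \<open>'m\<close>, i.e. it models the space of real n-by-m matrices.
\<close>

definition psd_matrices :: "(real^'n^'n) set" where
  "psd_matrices = {V. transpose V = V \<and> (\<forall>x. 0 \<le> x \<bullet> (V *v x))}"

definition support_function :: "(real^'n^'n) set \<Rightarrow> real^'n^'n \<Rightarrow> ereal" where
  "support_function M U = (SUP V\<in>M. ereal (trace (V ** U)))"

definition variational_gram :: "(real^'n^'n) set \<Rightarrow> real^'m^'n \<Rightarrow> ereal" where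
  "variational_gram M X = ereal (1/2) * support_function M (X ** transpose X)"

definition fenchel_conjugate :: "('a::real_inner \<Rightarrow> ereal) \<Rightarrow> 'a \<Rightarrow> ereal" where
  "fenchel_conjugate f Y = (SUP X. ereal (X \<bullet> Y) - f X)"

text \<open>The library inner product on matrices is the trace inner product.\<close>

lemma inner_matrix_eq_trace:
  fixes X Y :: "real^'m^'n"
  shows "X \<bullet> Y = trace (transpose X ** Y)"
proof -
  have "X \<bullet> Y = (\<Sum>i\<in>UNIV. \<Sum>j\<in>UNIV. X $ i $ j * Y $ i $ j)"
    by (simp add: inner_vec_def)
  also have "\<dots> = (\<Sum>j\<in>UNIV. \<Sum>i\<in>UNIV. X $ i $ j * Y $ i $ j)"
    by (rule sum.swap)
  also have "\<dots> = trace (transpose X ** Y)"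
    by (simp add: trace_def transpose_def matrix_matrix_mult_def)
  finally show ?thesis .
qed

definition is_pseudoinverse :: "real^'m^'n \<Rightarrow> real^'n^'m \<Rightarrow> bool" where
  "is_pseudoinverse A P \<longleftrightarrow>
     A ** P ** A = A \<and> P ** A ** P = P \<and>
     transpose (A ** P) = A ** P \<and> transpose (P ** A) = P ** A"

lemma is_pseudoinverse_unique:
  assumes P: "is_pseudoinverse A P" and Q: "is_pseudoinverse A Q"
  shows "P = Q"
proof -
  note p = P[unfolded is_pseudoinverse_def] and q = Q[unfolded is_pseudoinverse_def]
  have 1: "A ** P = A ** Q"
  proof -
    have "A ** P = transpose (A ** Q ** (A ** P))"
      using p q by (metis matrix_mul_assoc)
    also have "\<dots> = transpose (A ** P) ** transpose (A ** Q)"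
      by (rule matrix_transpose_mul)
    also have "\<dots> = A ** P ** (A ** Q)" using p q by simp
    also have "\<dots> = A ** Q" using p by (metis matrix_mul_assoc)
    finally show ?thesis .
  qed
  have 2: "P ** A = Q ** A"
  proof -
    have "P ** A = transpose (P ** A ** (Q ** A))"
      using p q by (metis matrix_mul_assoc)
    also have "\<dots> = transpose (Q ** A) ** transpose (P ** A)"
      by (rule matrix_transpose_mul)
    also have "\<dots> = Q ** A ** (P ** A)" using p q by simp
    also have "\<dots> = Q ** A" using p by (metis matrix_mul_assoc)
    finally show ?thesis .
  qed
  have "P = P ** (A ** P)" using p by (simp add: matrix_mul_assoc)
  also have "\<dots> = Q ** A ** Q" using 1 2 by (simp add: matrix_mul_assoc)
  finally show ?thesis using q by simp
qed

text \<open>The four Penrose conditions always have a solution, so the description is proper.\<close>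

definition pseudoinverse :: "real^'m^'n \<Rightarrow> real^'n^'m" where
  "pseudoinverse A = (THE P. is_pseudoinverse A P)"

definition matrix_range :: "real^'m^'n \<Rightarrow> (real^'n) set" where
  "matrix_range A = range ((*v) A)"

text \<open>
  The feasible set of the minimum may be empty (e.g. for \<open>M = {0}\<close> and \<open>X \<noteq> 0\<close>); an infimum
  over it, taken in \<open>ereal\<close>, is then \<open>\<infinity>\<close>.
\<close>

definition admissible :: "(real^'n^'n) set \<Rightarrow> real^'m^'n \<Rightarrow> (real^'n^'n) set" where
  "admissible M X = {V \<in> M. matrix_range X \<subseteq> matrix_range V}"

definition pinv_form :: "real^'m^'n \<Rightarrow> real^'n^'n \<Rightarrow> real" where
  "pinv_form X V = trace (transpose X ** pseudoinverse V ** X)"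

end

theory Submission
  imports Defs
begin

text \<open>
  For each \<open>V \<in> M\<close> the function \<open>X \<mapsto> \<langle>X,Y\<rangle> - \<langle>X,VX\<rangle>/2\<close> is concave and it is affine in \<open>V\<close>,
  so by minimax over the compact convex set \<open>M\<close> the conjugate at \<open>Y\<close> is at most \<open>c\<close> iff a
  single \<open>V \<in> M\<close> bounds \<open>\<langle>X,Y\<rangle> - \<langle>X,VX\<rangle>/2\<close> by \<open>c\<close> for all \<open>X\<close>. For fixed \<open>V\<close> this unconstrained
  quadratic problem is bounded iff \<open>rge Y \<subseteq> rge V\<close>, and then it is solved by \<open>X = V\<^sup>\<dagger>Y\<close>. Hence
  the sublevel set description of the conjugate already contains the formula, attainment and the
  finiteness criterion. Global finiteness yields an invertible element because \<open>V + W\<close> has a range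
  containing those of \<open>V\<close> and \<open>W\<close>, so an element of \<open>M\<close> of maximal rank has the largest range.
\<close>

section \<open>A minimax theorem\<close>

text \<open>
  The open epigraph of the support function of \<open>M\<close> is separated from the set of pairs
  \<open>(u, t)\<close> lying below all \<open>V \<bullet> u + b x - a x \<bullet> V - c\<close> for some \<open>x\<close>; the normal vector of the
  separating hyperplane is, up to scaling, the required point of \<open>M\<close>.
\<close>

lemma minimax_affine_concave:
  fixes M :: "'a::euclidean_space set" and a :: "'b::real_vector \<Rightarrow> 'a" and b :: "'b \<Rightarrow> real"
  assumes M: "convex M" "compact M"
    and conc: "\<And>V. V \<in> M \<Longrightarrow> concave_on UNIV (\<lambda>x. b x - a x \<bullet> V)"
    and le: "\<And>x. \<exists>V\<in>M. b x - a x \<bullet> V \<le> c"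
  shows "\<exists>V\<in>M. \<forall>x. b x - a x \<bullet> V \<le> c"
proof -
  define A :: "('a \<times> real) set" where "A = {(u, t). \<forall>V\<in>M. V \<bullet> u < t}"
  define B :: "('a \<times> real) set" where "B = {(u, t). \<exists>x. \<forall>V\<in>M. t - V \<bullet> u \<le> b x - a x \<bullet> V - c}"
  have "convex A"
    unfolding convex_def A_def
  proof clarsimp
    fix u1 t1 u2 t2 V and p q :: real
    assume "\<forall>V\<in>M. V \<bullet> u1 < t1" "\<forall>V\<in>M. V \<bullet> u2 < t2" "V \<in> M" and pq: "0 \<le> p" "0 \<le> q" "p + q = 1"
    then have V: "V \<bullet> u1 < t1" "V \<bullet> u2 < t2" by auto
    have "0 < p * (t1 - V \<bullet> u1) + q * (t2 - V \<bullet> u2)"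
      using V pq by (cases "p = 0") (auto intro!: add_pos_nonneg)
    then show "V \<bullet> (p *\<^sub>R u1 + q *\<^sub>R u2) < p * t1 + q * t2"
      by (simp add: inner_add_right algebra_simps)
  qed
  have "convex B"
    unfolding convex_def B_def
  proof clarsimp
    fix u1 t1 u2 t2 x1 x2 and p q :: real
    assume 1: "\<forall>V\<in>M. t1 - V \<bullet> u1 \<le> b x1 - a x1 \<bullet> V - c"
      and 2: "\<forall>V\<in>M. t2 - V \<bullet> u2 \<le> b x2 - a x2 \<bullet> V - c"
      and pq: "0 \<le> p" "0 \<le> q" "p + q = 1"
    have "p * t1 + q * t2 - V \<bullet> (p *\<^sub>R u1 + q *\<^sub>R u2)
        \<le> b (p *\<^sub>R x1 + q *\<^sub>R x2) - a (p *\<^sub>R x1 + q *\<^sub>R x2) \<bullet> V - c" if V: "V \<in> M" for V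
    proof -
      have "p * t1 + q * t2 - V \<bullet> (p *\<^sub>R u1 + q *\<^sub>R u2) = p * (t1 - V \<bullet> u1) + q * (t2 - V \<bullet> u2)"
        by (simp add: inner_add_right algebra_simps)
      also have "\<dots> \<le> p * (b x1 - a x1 \<bullet> V - c) + q * (b x2 - a x2 \<bullet> V - c)"
        using 1 2 V pq by (intro add_mono mult_left_mono) auto
      also have "\<dots> = p * (b x1 - a x1 \<bullet> V) + q * (b x2 - a x2 \<bullet> V) - (p + q) * c"
        by (simp add: algebra_simps)
      also have "\<dots> \<le> b (p *\<^sub>R x1 + q *\<^sub>R x2) - a (p *\<^sub>R x1 + q *\<^sub>R x2) \<bullet> V - c"
        using conc[OF V] pq by (simp add: concave_on_iff)
      finally show ?thesis .
    qed
    then show "\<exists>x. \<forall>V\<in>M. p * t1 + q * t2 - V \<bullet> (p *\<^sub>R u1 + q *\<^sub>R u2) \<le> b x - a x \<bullet> V - c"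
      by blast
  qed
  have "(0, 1) \<in> A" by (simp add: A_def)
  have aB: "(a x, b x - c) \<in> B" for x
    by (auto simp: B_def inner_commute intro!: exI[of _ x])
  have "A \<inter> B = {}"
  proof (rule ccontr)
    assume "A \<inter> B \<noteq> {}"
    then obtain u t x where *: "\<forall>V\<in>M. V \<bullet> u < t" "\<forall>V\<in>M. t - V \<bullet> u \<le> b x - a x \<bullet> V - c"
      by (auto simp: A_def B_def)
    obtain V where "V \<in> M" "b x - a x \<bullet> V \<le> c" using le by blast
    with * show False by fastforce
  qed
  with separating_hyperplane_sets[OF \<open>convex B\<close> \<open>convex A\<close>] aB \<open>(0, 1) \<in> A\<close>
  obtain n d where n: "n \<noteq> 0" "\<And>y. y \<in> B \<Longrightarrow> n \<bullet> y \<le> d" "\<And>y. y \<in> A \<Longrightarrow> d \<le> n \<bullet> y"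
    by blast
  obtain P r where P: "n = (P, r)" by force
  have A: "d \<le> P \<bullet> u + r * t" if "\<And>V. V \<in> M \<Longrightarrow> V \<bullet> u < t" for u t
    using n(3)[of "(u, t)"] that by (simp add: A_def P)
  have bound: "\<exists>t0 > 0. \<forall>t\<ge>t0. \<forall>V\<in>M. V \<bullet> u < t" for u
  proof -
    have "bounded ((\<lambda>V. V \<bullet> u) ` M)"
      by (intro compact_imp_bounded compact_continuous_image M continuous_intros)
    then obtain t0 where "t0 > 0" "\<forall>V\<in>M. \<bar>V \<bullet> u\<bar> \<le> t0" by (auto simp: bounded_pos)
    then show ?thesis by (intro exI[of _ "t0 + 1"]) fastforce
  qed
  have "r \<ge> 0"
  proof (rule ccontr)
    assume r: "\<not> r \<ge> 0"
    \<comment> \<open>For \<open>r < 0\<close> the points \<open>(0, t)\<close> of \<open>A\<close>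
      with \<open>t\<close> large fall below the bound \<open>d\<close>; the maximum keeps
      \<open>t\<close> positive.\<close>
    define t where "t = max 1 ((d - 1) / r)"
    have "d \<le> r * t" using A[of 0 t] by (simp add: t_def)
    moreover have "r * t \<le> d - 1"
      using r by (simp add: t_def field_simps max_def)
    ultimately show False by simp
  qed
  \<comment> \<open>A vertical hyperplane is impossible: \<open>A\<close> has points over every
    \<open>u\<close>, since \<open>M\<close> is bounded, and a nonzero linear functional is not
    bounded below.\<close>
  moreover have "r \<noteq> 0"
  proof
    assume r: "r = 0"
    then have "P \<noteq> 0" using n(1) P by (simp add: zero_prod_def)
    have "d \<le> P \<bullet> u" for u
      using bound[of u] A[of u] r by force
    from this[of "((d - 1) / (P \<bullet> P)) *\<^sub>R P"] \<open>P \<noteq> 0\<close> show False by simp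
  qed
  ultimately have r: "r > 0" by simp
  \<comment> \<open>Normalised so that the separating functional at \<open>(u, t)\<close> becomes
    \<open>r * (t - V0 \<bullet> u)\<close>.\<close>
  define V0 where "V0 = - (1 / r) *\<^sub>R P"
  have P_eq: "P = - r *\<^sub>R V0" using r by (simp add: V0_def)
  have A': "d \<le> r * (t - V0 \<bullet> u)" if "\<And>V. V \<in> M \<Longrightarrow> V \<bullet> u < t" for u t
    using A[OF that] by (simp add: P_eq algebra_simps)
  have "V0 \<in> M"
  proof (rule ccontr)
    assume "V0 \<notin> M"
    from separating_hyperplane_closed_point[OF M(1) compact_imp_closed[OF M(2)] this]
    obtain w e where w: "w \<bullet> V0 < e" "\<And>V. V \<in> M \<Longrightarrow> w \<bullet> V > e" by blast
    \<comment> \<open>scaling by \<open>s\<close> drives the separated pair to the wrong side of \<open>d\<close>\<close>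
    define s where "s = (\<bar>d\<bar> + 1) / (r * (e - w \<bullet> V0))"
    have s: "s > 0" using w r by (simp add: s_def)
    have "d \<le> r * (s * (- e) - V0 \<bullet> (- s *\<^sub>R w))"
      using w(2) s by (intro A') (simp add: inner_commute)
    also have "\<dots> = - (s * (r * (e - w \<bullet> V0)))" by (simp add: inner_commute algebra_simps)
    also have "\<dots> = - (\<bar>d\<bar> + 1)" using w r by (simp add: s_def)
    finally show False by simp
  qed
  moreover have "b x - a x \<bullet> V0 \<le> c" for x
  proof -
    \<comment> \<open>\<open>A\<close> contains \<open>(0, t)\<close> for arbitrarily small
      \<open>t > 0\<close>.\<close>
    have "d \<le> 0"
    proof (rule ccontr)
      assume d: "\<not> d \<le> 0"
      have "d \<le> r * (d / (2 * r))" using A'[of 0 "d / (2 * r)"] d r by simp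
      then show False using d r by simp
    qed
    moreover have "r * (b x - c - V0 \<bullet> a x) \<le> d"
      using n(2)[OF aB, of x] by (simp add: P P_eq algebra_simps)
    ultimately have "r * (b x - c - V0 \<bullet> a x) \<le> 0" by linarith
    then show ?thesis using r by (simp add: mult_le_0_iff inner_commute)
  qed
  ultimately show ?thesis by blast
qed

section \<open>Symmetric and positive semidefinite matrices\<close>

lemma matrix_sub_ldistrib:
  fixes A :: "real^'n^'k"
  shows "A ** (X - Y) = A ** X - A ** Y"
  using matrix_add_ldistrib[of A "X - Y" Y] by simp

lemma inner_matrix_mul_left:
  fixes A :: "real^'n^'n" and X Y :: "real^'m^'n"
  shows "(A ** X) \<bullet> Y = X \<bullet> (transpose A ** Y)"
  by (simp add: inner_matrix_eq_trace matrix_transpose_mul matrix_mul_assoc)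

section \<open>Range, kernel and pseudoinverse of a symmetric matrix\<close>

lemma inner_sym_matrix_vector:
  fixes V :: "real^'n^'n"
  assumes "transpose V = V"
  shows "(V *v x) \<bullet> y = x \<bullet> (V *v y)"
  by (metis assms dot_lmul_matrix vector_transpose_matrix)

text \<open>Split \<open>x\<close> orthogonally along the range. If \<open>z\<close> is orthogonal
  to the range, moving one factor \<open>V\<close> across the inner product in the squared norm of
  \<open>V *v z\<close> gives 0.\<close>

lemma sym_matrix_range_decomp:
  fixes V :: "real^'n^'n"
  assumes "transpose V = V"
  obtains r z where "r \<in> matrix_range V" "V *v z = 0" "x = r + z"
proof -
  have span: "span (matrix_range V) = matrix_range V"
    unfolding matrix_range_def by (simp add: linear_subspace_image)
  obtain r z where rz: "r \<in> span (matrix_range V)" "\<And>w. w \<in> span (matrix_range V) \<Longrightarrow> orthogonal z w"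
    "x = r + z"
    using orthogonal_subspace_decomp_exists by blast
  have "(V *v z) \<bullet> (V *v z) = z \<bullet> (V *v (V *v z))"
    by (rule inner_sym_matrix_vector[OF assms])
  also have "\<dots> = 0"
    using rz(2) unfolding span by (simp add: matrix_range_def orthogonal_def)
  finally have "V *v z = 0" by simp
  with rz that show thesis unfolding span by blast
qed

lemma sym_matrix_range_ortho_kernel:
  fixes V :: "real^'n^'n"
  assumes "transpose V = V" "r \<in> matrix_range V" "V *v z = 0"
  shows "r \<bullet> z = 0"
  using assms by (auto simp: matrix_range_def inner_sym_matrix_vector)

text \<open>
  \<open>g\<close> inverts \<open>V\<close> on its range and \<open>g \<circ> V\<close> is the orthogonal projection onto that range.
\<close>

lemma sym_matrix_pseudoinverse_exists:
  fixes V :: "real^'n^'n"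
  assumes V: "transpose V = V"
  shows "\<exists>P. is_pseudoinverse V P"
proof -
  define R where "R = matrix_range V"
  have "subspace R" by (simp add: R_def matrix_range_def linear_subspace_image)
  have "inj_on ((*v) V) R"
  proof (rule inj_onI)
    fix x y assume xy: "x \<in> R" "y \<in> R" "V *v x = V *v y"
    then have "x - y \<in> R" using \<open>subspace R\<close> by (simp add: subspace_diff)
    moreover have "V *v (x - y) = 0" using xy by (simp add: matrix_vector_mult_diff_distrib)
    ultimately have "(x - y) \<bullet> (x - y) = 0"
      using sym_matrix_range_ortho_kernel[OF V] R_def by blast
    then show "x = y" by simp
  qed
  then obtain g where g: "range g \<subseteq> R" "linear g" "\<And>v. v \<in> R \<Longrightarrow> g (V *v v) = v"
    using linear_exists_left_inverse_on[OF matrix_vector_mul_linear \<open>subspace R\<close>] by metis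
  define G where "G = matrix g"
  have G: "G *v x = g x" for x using g(2) by (simp add: G_def)
  define Q where "Q = G ** V"
  \<comment> \<open>\<open>G\<close> inverts \<open>V\<close> only on \<open>R\<close>; applying the
    projection \<open>Q\<close> first discards the arbitrary values of \<open>G\<close> on the
    kernel of \<open>V\<close>.\<close>
  define P where "P = G ** Q"
  have Qx: "Q *v x = g (V *v x)" for x by (simp add: Q_def G flip: matrix_vector_mul_assoc)
  have QR: "Q *v x \<in> R" for x using g(1) Qx by auto
  have Qid: "Q *v v = v" if "v \<in> R" for v using g(3) that Qx by simp
  have VQx: "V *v (Q *v x) = V *v x" for x
  proof -
    obtain r z where "r \<in> R" "V *v z = 0" "x = r + z"
      using sym_matrix_range_decomp[OF V] R_def by metis
    then show ?thesis
      using Qx[of x] g(3) by (simp add: matrix_vector_right_distrib)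
  qed
  have VQ: "V ** Q = V"
    by (simp add: matrix_eq VQx flip: matrix_vector_mul_assoc)
  have QQ: "Q ** Q = Q"
    by (simp add: matrix_eq Qid QR flip: matrix_vector_mul_assoc)
  have QG: "Q ** G = G"
    using g(1) by (auto simp: matrix_eq G intro!: Qid simp flip: matrix_vector_mul_assoc)
  have QV: "Q ** V = V"
    by (auto simp: matrix_eq R_def matrix_range_def intro!: Qid simp flip: matrix_vector_mul_assoc)
  have Qsym: "transpose Q = Q"
  proof -
    \<comment> \<open>\<open>y - Q *v y\<close> lies in the kernel of \<open>V\<close>, hence is
      orthogonal to \<open>R\<close>. The right-hand side is symmetric in \<open>x\<close> and
      \<open>y\<close>, which makes \<open>Q\<close> self-adjoint.\<close>
    have *: "(Q *v x) \<bullet> y = (Q *v x) \<bullet> (Q *v y)" for x y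
    proof -
      have "V *v (y - Q *v y) = 0" by (simp add: matrix_vector_mult_diff_distrib VQx)
      then have "(Q *v x) \<bullet> (y - Q *v y) = 0"
        using sym_matrix_range_ortho_kernel[OF V] QR R_def by blast
      then show ?thesis by (simp add: inner_diff_right)
    qed
    have "x \<bullet> (transpose Q *v y) = x \<bullet> (Q *v y)" for x y
    proof -
      have "x \<bullet> (transpose Q *v y) = (Q *v x) \<bullet> y"
        by (metis dot_lmul_matrix transpose_transpose vector_transpose_matrix)
      also have "\<dots> = x \<bullet> (Q *v y)" by (metis * inner_commute)
      finally show ?thesis .
    qed
    then have "transpose Q *v y = Q *v y" for y
      using vector_eq_ldot by blast
    then show ?thesis by (simp add: matrix_eq)
  qed
  have PV: "P ** V = Q" by (metis P_def QV Q_def matrix_mul_assoc)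
  have VP: "V ** P = Q"
  proof -
    have "V *v (G *v v) = v" if v: "v \<in> R" for v
    proof -
      obtain x where "v = V *v x" using v by (auto simp: R_def matrix_range_def)
      then show ?thesis using VQx[of x] Qx G by simp
    qed
    then have "V *v (P *v x) = Q *v x" for x
      by (simp add: P_def QR flip: matrix_vector_mul_assoc)
    then show ?thesis by (simp add: matrix_eq flip: matrix_vector_mul_assoc)
  qed
  have "Q ** P = P" by (simp add: P_def QG matrix_mul_assoc)
  with PV VP QV Qsym have "is_pseudoinverse V P"
    by (simp add: is_pseudoinverse_def)
  then show ?thesis by blast
qed

lemma sym_matrix_pseudoinverse:
  fixes V :: "real^'n^'n"
  assumes "transpose V = V"
  shows "is_pseudoinverse V (pseudoinverse V)"
  unfolding pseudoinverse_def
  using sym_matrix_pseudoinverse_exists[OF assms] is_pseudoinverse_unique by (metis theI)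

text \<open>Since \<open>V ** P ** V = V\<close>, the vectors fixed by \<open>V ** P\<close> are
  exactly those in the range of \<open>V\<close>.\<close>

lemma matrix_range_subset_iff_pseudoinverse:
  fixes Y :: "real^'m^'n"
  assumes "is_pseudoinverse V P"
  shows "matrix_range Y \<subseteq> matrix_range V \<longleftrightarrow> V ** (P ** Y) = Y"
proof
  have VPV: "V ** P ** V = V" using assms by (simp add: is_pseudoinverse_def)
  assume L: "matrix_range Y \<subseteq> matrix_range V"
  have "V *v (P *v (Y *v x)) = Y *v x" for x
  proof -
    obtain z where "Y *v x = V *v z" using L by (auto simp: matrix_range_def)
    then show ?thesis using VPV by (metis matrix_vector_mul_assoc)
  qed
  then show "V ** (P ** Y) = Y" by (simp add: matrix_eq flip: matrix_vector_mul_assoc)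
next
  assume "V ** (P ** Y) = Y"
  then have "Y *v x = V *v ((P ** Y) *v x)" for x by (simp add: matrix_vector_mul_assoc)
  then show "matrix_range Y \<subseteq> matrix_range V" by (auto simp: matrix_range_def)
qed

section \<open>Forms and ranges of positive semidefinite matrices\<close>

lemma psd_matrices_sym: "V \<in> psd_matrices \<Longrightarrow> transpose V = V"
  by (simp add: psd_matrices_def)

lemma psd_matrices_vector_nonneg: "V \<in> psd_matrices \<Longrightarrow> 0 \<le> x \<bullet> (V *v x)"
  by (simp add: psd_matrices_def)

text \<open>The trace form splits into one vector form for each column of \<open>X\<close>.\<close>

lemma psd_matrices_inner_nonneg:
  fixes X :: "real^'m^'n"
  assumes "V \<in> psd_matrices"
  shows "0 \<le> X \<bullet> (V ** X)"
proof -
  have "X \<bullet> (V ** X) = (\<Sum>j\<in>UNIV. column j X \<bullet> (V *v column j X))"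
    by (simp add: inner_vec_def matrix_matrix_mult_def matrix_vector_mult_def column_def)
      (rule sum.swap)
  also have "\<dots> \<ge> 0"
    by (intro sum_nonneg psd_matrices_vector_nonneg[OF assms])
  finally show ?thesis .
qed

text \<open>Moving from the zero \<open>x\<close> of the form in direction \<open>- (V *v x)\<close>
  would make the form negative to first order unless \<open>V *v x = 0\<close>.\<close>

lemma psd_matrices_vector_eq_0:
  fixes V :: "real^'n^'n"
  assumes V: "V \<in> psd_matrices" and 0: "x \<bullet> (V *v x) = 0"
  shows "V *v x = 0"
proof -
  define y where "y = V *v x"
  define b where "b = y \<bullet> (V *v y)"
  \<comment> \<open>A step short enough that the form drops to \<open>- t * t * (b + 2)\<close>; the
    summand 1 keeps the denominator positive when \<open>b = 0\<close>.\<close>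
  define t where "t = (y \<bullet> y) / (b + 1)"
  have b: "b \<ge> 0" using psd_matrices_vector_nonneg[OF V] by (simp add: b_def)
  have "x \<bullet> (V *v y) = y \<bullet> y"
    using inner_sym_matrix_vector[OF psd_matrices_sym[OF V], of x y] by (simp add: y_def)
  then have "(x - t *\<^sub>R y) \<bullet> (V *v (x - t *\<^sub>R y)) = - 2 * t * (y \<bullet> y) + t * (t * b)"
    using 0 by (simp add: matrix_vector_mult_diff_distrib matrix_vector_mult_scaleR inner_diff_left
        inner_diff_right b_def algebra_simps flip: y_def)
  then have "0 \<le> - 2 * t * (y \<bullet> y) + t * (t * b)"
    using psd_matrices_vector_nonneg[OF V] by metis
  moreover have "y \<bullet> y = t * (b + 1)" using b by (simp add: t_def)
  ultimately have "t * t * (b + 2) \<le> 0" by (simp add: algebra_simps)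
  then have "t = 0" using b by (auto simp: mult_le_0_iff)
  then have "y \<bullet> y = 0" using b by (simp add: t_def)
  then show ?thesis by (simp add: y_def)
qed

lemma psd_matrices_add:
  assumes "V \<in> psd_matrices" "W \<in> psd_matrices"
  shows "V + W \<in> psd_matrices"
proof -
  have "transpose (V + W) = transpose V + transpose W"
    by (simp add: transpose_def vec_eq_iff)
  then show ?thesis
    using assms by (simp add: psd_matrices_def matrix_vector_mult_add_rdistrib inner_add_right)
qed

text \<open>Both forms are nonnegative, so a kernel vector of \<open>V + W\<close> is a zero of each
  and lies in the kernel of \<open>V\<close>; ranges are the orthogonal complements of
  kernels.\<close>

lemma psd_matrices_range_add:
  fixes V :: "real^'n^'n"
  assumes V: "V \<in> psd_matrices" and W: "W \<in> psd_matrices"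
  shows "matrix_range V \<subseteq> matrix_range (V + W)"
proof
  fix v assume v: "v \<in> matrix_range V"
  note T = psd_matrices_sym[OF psd_matrices_add[OF V W]]
  obtain r z where rz: "r \<in> matrix_range (V + W)" "(V + W) *v z = 0" "v = r + z"
    using sym_matrix_range_decomp[OF T] by metis
  have "z \<bullet> (V *v z) + z \<bullet> (W *v z) = 0"
    using arg_cong[OF rz(2), of "\<lambda>y. z \<bullet> y"]
    by (simp add: matrix_vector_mult_add_rdistrib inner_add_right)
  then have "V *v z = 0"
    using psd_matrices_vector_nonneg[OF V, of z] psd_matrices_vector_nonneg[OF W, of z]
    by (intro psd_matrices_vector_eq_0[OF V]) linarith
  then have "v \<bullet> z = 0" by (rule sym_matrix_range_ortho_kernel[OF psd_matrices_sym[OF V] v])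
  moreover have "r \<bullet> z = 0" by (rule sym_matrix_range_ortho_kernel[OF T rz(1,2)])
  ultimately have "z = 0" using rz(3) by (simp add: inner_add_left)
  then show "v \<in> matrix_range (V + W)" using rz by simp
qed

lemma matrix_range_scaleR:
  fixes A :: "real^'m^'n"
  assumes "c \<noteq> 0"
  shows "matrix_range (c *\<^sub>R A) = matrix_range A"
proof -
  have *: "(c *\<^sub>R A) *v x = A *v (c *\<^sub>R x)" for x
    by (simp add: matrix_vector_mult_scaleR scaleR_matrix_vector_assoc)
  have "A *v x = (c *\<^sub>R A) *v ((1 / c) *\<^sub>R x)" for x
    using assms * by simp
  then have "A *v x \<in> range ((*v) (c *\<^sub>R A))" for x
    by (metis rangeI)
  then show ?thesis by (auto simp: matrix_range_def *)
qed

lemma invertible_iff_matrix_range: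
  fixes V :: "real^'n^'n"
  shows "invertible V \<longleftrightarrow> matrix_range V = UNIV"
  by (simp add: invertible_right_inverse matrix_right_invertible_surjective matrix_range_def)

lemma psd_matrices_form_convex:
  assumes V: "V \<in> psd_matrices"
  shows "convex_on UNIV (\<lambda>X :: real^'m^'n. X \<bullet> (V ** X))"
proof (rule convex_onI)
  fix t :: real and X Y :: "real^'m^'n" assume t: "0 < t" "t < 1"
  have sym: "Y \<bullet> (V ** X) = X \<bullet> (V ** Y)"
    using inner_matrix_mul_left[of V X Y] psd_matrices_sym[OF V] by (simp add: inner_commute)
  \<comment> \<open>The convexity defect is a nonnegative multiple of the form at
    \<open>X - Y\<close>.\<close>
  have "(1 - t) * (X \<bullet> (V ** X)) + t * (Y \<bullet> (V ** Y))
      - ((1 - t) *\<^sub>R X + t *\<^sub>R Y) \<bullet> (V ** ((1 - t) *\<^sub>R X + t *\<^sub>R Y))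
      = (1 - t) * t * ((X - Y) \<bullet> (V ** (X - Y)))"
    by (simp add: matrix_add_ldistrib matrix_sub_ldistrib matrix_scalar_ac inner_add_left inner_add_right
        inner_diff_left inner_diff_right sym flip: scalar_matrix_assoc) (simp add: algebra_simps)
  also have "\<dots> \<ge> 0" using t by (intro mult_nonneg_nonneg psd_matrices_inner_nonneg[OF V]) auto
  finally show "((1 - t) *\<^sub>R X + t *\<^sub>R Y) \<bullet> (V ** ((1 - t) *\<^sub>R X + t *\<^sub>R Y))
      \<le> (1 - t) * (X \<bullet> (V ** X)) + t * (Y \<bullet> (V ** Y))" by simp
qed simp

section \<open>The quadratic problem for a fixed matrix\<close>

lemma psd_quadratic_bounded_iff:
  fixes Y :: "real^'m^'n"
  assumes V: "V \<in> psd_matrices"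
  shows "(\<forall>X. X \<bullet> Y - 1/2 * (X \<bullet> (V ** X)) \<le> c) \<longleftrightarrow>
    matrix_range Y \<subseteq> matrix_range V \<and> 1/2 * pinv_form Y V \<le> c"
proof -
  define P where "P = pseudoinverse V"
  note Vt = psd_matrices_sym[OF V]
  have P: "is_pseudoinverse V P"
    unfolding P_def by (rule sym_matrix_pseudoinverse[OF Vt])
  then have VPV: "V ** P ** V = V" and VPt: "transpose (V ** P) = V ** P"
    by (simp_all add: is_pseudoinverse_def)
  have pf: "pinv_form Y V = (P ** Y) \<bullet> Y"
    unfolding pinv_form_def P_def[symmetric]
    by (metis inner_commute inner_matrix_eq_trace matrix_mul_assoc)
  show ?thesis
  proof (intro iffI conjI allI)
    assume le: "\<forall>X. X \<bullet> Y - 1/2 * (X \<bullet> (V ** X)) \<le> c"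
    \<comment> \<open>\<open>Z\<close> is the part of \<open>Y\<close> orthogonal to the range of \<open>V\<close>\<close>
    define Z where "Z = Y - V ** P ** Y"
    have "V ** (V ** P) = V"
      using arg_cong[OF VPV, of transpose] by (simp add: matrix_transpose_mul Vt VPt)
        (metis VPt Vt matrix_transpose_mul matrix_mul_assoc)
    then have VZ: "V ** Z = 0"
      by (simp add: Z_def matrix_sub_ldistrib matrix_mul_assoc)
    have "Z \<bullet> (V ** P ** Y) = (V ** Z) \<bullet> (P ** Y)"
      by (simp add: inner_matrix_mul_left Vt matrix_mul_assoc)
    then have ZY: "Z \<bullet> Y = Z \<bullet> Z"
      by (simp add: VZ) (simp add: Z_def inner_diff_right)
    have "Z = 0"
    proof (rule ccontr)
      assume "Z \<noteq> 0"
      \<comment> \<open>Along the line \<open>s *\<^sub>R Z\<close> the quadratic term vanishes, and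
        a bounded linear function of \<open>s\<close> forces \<open>Z = 0\<close>.\<close>
      have "s * (Z \<bullet> Z) \<le> c" for s
        using le[rule_format, of "s *\<^sub>R Z"] by (simp add: matrix_scalar_ac VZ ZY flip: scalar_matrix_assoc)
      from this[of "(c + 1) / (Z \<bullet> Z)"] \<open>Z \<noteq> 0\<close> show False by simp
    qed
    then have Y: "V ** (P ** Y) = Y" by (simp add: Z_def matrix_mul_assoc)
    then show "matrix_range Y \<subseteq> matrix_range V"
      by (simp add: matrix_range_subset_iff_pseudoinverse[OF P])
    show "1/2 * pinv_form Y V \<le> c"
      using le[rule_format, of "P ** Y"] by (simp add: Y pf)
  next
    fix X
    assume "matrix_range Y \<subseteq> matrix_range V \<and> 1/2 * pinv_form Y V \<le> c"
    then have Y: "V ** (P ** Y) = Y" and c: "1/2 * pinv_form Y V \<le> c"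
      by (simp_all add: matrix_range_subset_iff_pseudoinverse[OF P])
    define W where "W = P ** Y"
    have sym: "W \<bullet> (V ** X) = X \<bullet> Y"
      using inner_matrix_mul_left[of V W X] Y by (simp add: Vt W_def inner_commute)
    \<comment> \<open>Completing the square around the maximiser \<open>W\<close>.\<close>
    have "0 \<le> (X - W) \<bullet> (V ** (X - W))" by (rule psd_matrices_inner_nonneg[OF V])
    also have "\<dots> = X \<bullet> (V ** X) - 2 * (X \<bullet> Y) + pinv_form Y V"
      using Y sym by (simp add: matrix_sub_ldistrib inner_diff_left inner_diff_right pf flip: W_def)
    finally show "X \<bullet> Y - 1/2 * (X \<bullet> (V ** X)) \<le> c" using c by simp
  qed
qed

section \<open>The conjugate of a variational Gram function\<close>

text \<open>By symmetry of the elements of \<open>M\<close>, the form is the linear functional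
  \<open>V \<bullet> (X ** transpose X)\<close> there, so it has a maximum on the compact set
  \<open>M\<close>.\<close>

lemma variational_gram_attained:
  fixes X :: "real^'m^'n"
  assumes M: "M \<subseteq> psd_matrices" "M \<noteq> {}" "compact M"
  obtains V where "V \<in> M" "variational_gram M X = ereal (1/2 * (X \<bullet> (V ** X)))"
    "\<And>W. W \<in> M \<Longrightarrow> X \<bullet> (W ** X) \<le> X \<bullet> (V ** X)"
proof -
  have tr: "trace (V ** (X ** transpose X)) = X \<bullet> (V ** X)" for V
    by (metis inner_matrix_eq_trace matrix_mul_assoc trace_mul_sym)
  have "V \<bullet> (X ** transpose X) = X \<bullet> (V ** X)" if "V \<in> M" for V
    using that M psd_matrices_sym[of V] by (auto simp: inner_matrix_eq_trace[of V] tr)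
  moreover have "continuous_on M (\<lambda>V. V \<bullet> (X ** transpose X))"
    by (intro continuous_intros)
  ultimately have "continuous_on M (\<lambda>V. X \<bullet> (V ** X))"
    by (simp cong: continuous_on_cong)
  then obtain V where V: "V \<in> M" "\<And>W. W \<in> M \<Longrightarrow> X \<bullet> (W ** X) \<le> X \<bullet> (V ** X)"
    using continuous_attains_sup[OF M(3,2)] by blast
  have "support_function M (X ** transpose X) = ereal (X \<bullet> (V ** X))"
    unfolding support_function_def tr using V by (intro antisym SUP_least SUP_upper2) auto
  with V that show thesis by (simp add: variational_gram_def)
qed

lemma fenchel_conjugate_variational_gram_le_iff:
  fixes Y :: "real^'m^'n"
  assumes M: "M \<subseteq> psd_matrices" "M \<noteq> {}" "convex M" "compact M"
  shows "fenchel_conjugate (variational_gram M) Y \<le> ereal c \<longleftrightarrow>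
    (\<exists>V\<in>admissible M Y. 1/2 * pinv_form Y V \<le> c)"
proof -
  \<comment> \<open>Linearity in \<open>V\<close> on \<open>M\<close>, in the shape that
    \<open>minimax_affine_concave\<close> asks for: the matrix on the right serves as
    \<open>a x\<close>.\<close>
  have form: "1/2 * (X \<bullet> (V ** X)) = (1/2) *\<^sub>R (X ** transpose X) \<bullet> V"
    if "V \<in> M" for V and X :: "real^'m^'n"
  proof -
    have "X \<bullet> (V ** X) = trace (transpose V ** (X ** transpose X))"
      using that M(1) psd_matrices_sym
      by (metis inner_matrix_eq_trace matrix_mul_assoc trace_mul_sym subsetD)
    also have "\<dots> = (X ** transpose X) \<bullet> V"
      by (metis inner_commute inner_matrix_eq_trace)
    finally show ?thesis by simp
  qed
  have "fenchel_conjugate (variational_gram M) Y \<le> ereal c \<longleftrightarrow>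
      (\<forall>X. \<exists>V\<in>M. X \<bullet> Y - 1/2 * (X \<bullet> (V ** X)) \<le> c)"
    unfolding fenchel_conjugate_def SUP_le_iff ball_UNIV
  proof (intro iff_allI)
    fix X :: "real^'m^'n"
    \<comment> \<open>A maximiser turns the bound on the difference into a bound at a single
      \<open>V\<close>; a supremum that is only approached would give values close to
      \<open>c\<close>.\<close>
    obtain V where V: "V \<in> M" "variational_gram M X = ereal (1/2 * (X \<bullet> (V ** X)))"
      "\<And>W. W \<in> M \<Longrightarrow> X \<bullet> (W ** X) \<le> X \<bullet> (V ** X)"
      using variational_gram_attained[OF M(1,2,4)] by metis
    then show "ereal (X \<bullet> Y) - variational_gram M X \<le> ereal c \<longleftrightarrow>
        (\<exists>V\<in>M. X \<bullet> Y - 1/2 * (X \<bullet> (V ** X)) \<le> c)"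
      by (force simp del: divide_le_eq)
  qed
  also have "\<dots> \<longleftrightarrow> (\<exists>V\<in>M. \<forall>X. X \<bullet> Y - 1/2 * (X \<bullet> (V ** X)) \<le> c)"
  proof
    assume *: "\<forall>X. \<exists>V\<in>M. X \<bullet> Y - 1/2 * (X \<bullet> (V ** X)) \<le> c"
    have "\<exists>V\<in>M. \<forall>X. X \<bullet> Y - (1/2) *\<^sub>R (X ** transpose X) \<bullet> V \<le> c"
    proof (rule minimax_affine_concave[OF M(3,4)])
      fix V assume V: "V \<in> M"
      have "convex_on UNIV (\<lambda>X. X \<bullet> Y * - 1 + 1/2 * (X \<bullet> (V ** X)))"
        using psd_matrices_form_convex[of V] V M(1)
        by (intro convex_on_add convex_on_cmul)
          (auto simp: convex_on_def inner_add_left)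
      then show "concave_on UNIV (\<lambda>X. X \<bullet> Y - (1/2) *\<^sub>R (X ** transpose X) \<bullet> V)"
        unfolding concave_on_def form[OF V] by (simp add: algebra_simps)
    next
      fix X show "\<exists>V\<in>M. X \<bullet> Y - (1/2) *\<^sub>R (X ** transpose X) \<bullet> V \<le> c"
        using * form by metis
    qed
    then show "\<exists>V\<in>M. \<forall>X. X \<bullet> Y - 1/2 * (X \<bullet> (V ** X)) \<le> c"
      using form by metis
  qed blast
  also have "\<dots> \<longleftrightarrow> (\<exists>V\<in>admissible M Y. 1/2 * pinv_form Y V \<le> c)"
    using psd_quadratic_bounded_iff M(1) unfolding admissible_def by blast
  finally show ?thesis .
qed

text \<open>Testing with the zero matrix; this rules out the value
  \<open>-\<infinity>\<close>.\<close>

lemma fenchel_conjugate_variational_gram_nonneg: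
  fixes Y :: "real^'m^'n"
  assumes "M \<noteq> {}"
  shows "0 \<le> fenchel_conjugate (variational_gram M) Y"
proof -
  have "variational_gram M (0 :: real^'m^'n) = 0"
    using assms by (simp add: variational_gram_def support_function_def trace_def zero_ereal_def)
  then have "0 = ereal ((0 :: real^'m^'n) \<bullet> Y) - variational_gram M (0 :: real^'m^'n)" by simp
  also have "\<dots> \<le> fenchel_conjugate (variational_gram M) Y"
    unfolding fenchel_conjugate_def by (rule SUP_upper) simp
  finally show ?thesis .
qed

text \<open>At a finite value \<open>c\<close> the sublevel criterion supplies an admissible
  \<open>V\<close> of half-form at most \<open>c\<close>; read backwards, it makes the half-form of
  every admissible \<open>W\<close> at least \<open>c\<close>.\<close>

lemma fenchel_conjugate_variational_gram_cases:
  fixes Y :: "real^'m^'n"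
  assumes M: "M \<subseteq> psd_matrices" "M \<noteq> {}" "convex M" "compact M"
  obtains (infinite) "admissible M Y = {}" "fenchel_conjugate (variational_gram M) Y = \<infinity>"
    | (attained) V where "V \<in> admissible M Y"
        "fenchel_conjugate (variational_gram M) Y = ereal (1/2 * pinv_form Y V)"
        "\<And>W. W \<in> admissible M Y \<Longrightarrow> pinv_form Y V \<le> pinv_form Y W"
proof -
  note le_iff = fenchel_conjugate_variational_gram_le_iff[OF M, of Y]
  consider c where "fenchel_conjugate (variational_gram M) Y = ereal c"
    | "fenchel_conjugate (variational_gram M) Y = \<infinity>"
    using fenchel_conjugate_variational_gram_nonneg[OF M(2), of Y]
    by (cases "fenchel_conjugate (variational_gram M) Y") auto
  then show thesis
  proof cases
    case 1
    then obtain V where V: "V \<in> admissible M Y" "1/2 * pinv_form Y V \<le> c"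
      using le_iff[of c] by auto
    have lower: "c \<le> 1/2 * pinv_form Y W" if "W \<in> admissible M Y" for W
      using le_iff[of "1/2 * pinv_form Y W"] that 1 by auto
    have "c = 1/2 * pinv_form Y V" using V lower by force
    with V 1 lower show ?thesis by (intro attained[of V]) auto
  next
    case 2
    have "admissible M Y = {}"
      using le_iff 2 by fastforce
    with 2 infinite show ?thesis by blast
  qed
qed

section \<open>Global finiteness and invertible elements\<close>

lemma invertible_of_all_admissible:
  fixes M :: "(real^'n^'n) set"
  assumes M: "M \<subseteq> psd_matrices" "M \<noteq> {}" "convex M"
    and adm: "\<And>X :: real^'m^'n. admissible M X \<noteq> {}"
  shows "\<exists>V\<in>M. invertible V"
proof -
  define d where "d = (\<lambda>V :: real^'n^'n. dim (matrix_range V))"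
  have "\<forall>V. V \<in> M \<longrightarrow> d V < Suc (DIM(real^'n))"
    unfolding d_def by (simp only: less_Suc_eq_le dim_subset_UNIV) simp
  then obtain V where V: "V \<in> M" "\<And>W. W \<in> M \<Longrightarrow> d W \<le> d V"
    using ex_has_greatest_nat[of "\<lambda>V. V \<in> M" _ d] M(2) by (metis ex_in_conv)
  have "x \<in> matrix_range V" for x
  proof -
    \<comment> \<open>All columns equal \<open>x\<close>, so admissibility of \<open>W\<close> for
      \<open>X\<close> places \<open>x\<close> in the range of \<open>W\<close>; any basis vector
      extracts a column.\<close>
    define X :: "real^'m^'n" where "X = (\<chi> i j. x $ i)"
    obtain W where W: "W \<in> M" "matrix_range X \<subseteq> matrix_range W"
      using adm[of X] by (auto simp: admissible_def)
    have "X *v axis undefined 1 = x"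
      by (simp add: X_def matrix_vector_mul_component column_def vec_eq_iff matrix_vector_mult_basis)
    then have xW: "x \<in> matrix_range W" using W(2) by (auto simp: matrix_range_def)
    \<comment> \<open>The midpoint stays in the convex set \<open>M\<close> and has the range of
      \<open>V + W\<close>; maximality of the rank of \<open>V\<close> then makes the ranges of
      \<open>T\<close> and \<open>V\<close> equal.\<close>
    define T where "T = (1/2) *\<^sub>R V + (1/2) *\<^sub>R W"
    have "T \<in> M" using V(1) W(1) M(3) by (simp add: T_def convexD)
    have T: "matrix_range T = matrix_range (V + W)"
      using matrix_range_scaleR[of "1/2" "V + W"] by (simp add: T_def scaleR_add_right)
    have psd: "V \<in> psd_matrices" "W \<in> psd_matrices" using V(1) W(1) M(1) by auto
    have "matrix_range V \<subseteq> matrix_range T"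
      unfolding T by (rule psd_matrices_range_add[OF psd])
    moreover have "dim (matrix_range T) \<le> dim (matrix_range V)"
      using V(2)[OF \<open>T \<in> M\<close>] by (simp add: d_def)
    ultimately have "matrix_range V = matrix_range T"
      by (intro subspace_dim_equal) (simp_all add: matrix_range_def linear_subspace_image)
    then show ?thesis
      using xW psd_matrices_range_add[OF psd(2,1)] T by (auto simp: add.commute)
  qed
  then show ?thesis using V(1) by (auto simp: invertible_iff_matrix_range)
qed

text \<open>Finiteness takes the form of a criterion because the conjugate can be infinite: for
  \<open>M = {0}\<close> it is \<open>\<infinity>\<close> at every nonzero \<open>X\<close>. It is
  finite everywhere exactly when \<open>M\<close> has an invertible element.\<close>

theorem proposition30:
  fixes M :: "(real^'n^'n) set"
  assumes "M \<subseteq> psd_matrices" and "M \<noteq> {}" and "convex M" and "compact M"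
  shows "(\<forall>X :: real^'m^'n.
            fenchel_conjugate (variational_gram M) X =
              ereal (1/2) * (INF V\<in>admissible M X. ereal (pinv_form X V)) \<and>
            (admissible M X \<noteq> {} \<longrightarrow>
              (\<exists>V. is_arg_min (pinv_form X) (\<lambda>V. V \<in> admissible M X) V)) \<and>
            (\<bar>fenchel_conjugate (variational_gram M) X\<bar> \<noteq> \<infinity> \<longleftrightarrow> admissible M X \<noteq> {})) \<and>
         ((\<forall>X :: real^'m^'n. \<bar>fenchel_conjugate (variational_gram M) X\<bar> \<noteq> \<infinity>) \<longleftrightarrow>
            (\<exists>V\<in>M. invertible V))"
proof -
  have main: "fenchel_conjugate (variational_gram M) X =
              ereal (1/2) * (INF V\<in>admissible M X. ereal (pinv_form X V)) \<and>
            (admissible M X \<noteq> {} \<longrightarrow>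
              (\<exists>V. is_arg_min (pinv_form X) (\<lambda>V. V \<in> admissible M X) V)) \<and>
            (\<bar>fenchel_conjugate (variational_gram M) X\<bar> \<noteq> \<infinity> \<longleftrightarrow> admissible M X \<noteq> {})"
    for X :: "real^'m^'n"
  proof (rule fenchel_conjugate_variational_gram_cases[OF assms, of X], goal_cases)
    case 1
    then show ?thesis by (simp add: top_ereal_def)
  next
    case (2 V)
    note attained = 2
    have "(INF V\<in>admissible M X. ereal (pinv_form X V)) = ereal (pinv_form X V)"
      using attained by (intro antisym INF_greatest INF_lower2) auto
    moreover have "is_arg_min (pinv_form X) (\<lambda>V. V \<in> admissible M X) V"
      using attained by (auto simp: is_arg_min_linorder)
    ultimately show ?thesis using attained by auto
  qed
  have "(\<forall>X :: real^'m^'n. admissible M X \<noteq> {}) \<longleftrightarrow> (\<exists>V\<in>M. invertible V)"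
    using invertible_of_all_admissible[OF assms(1-3)]
    by (auto simp: admissible_def invertible_iff_matrix_range)
  moreover have fin: "(\<bar>fenchel_conjugate (variational_gram M) X\<bar> \<noteq> \<infinity>) = (admissible M X \<noteq> {})"
    for X :: "real^'m^'n"
    by (rule conjunct2[OF conjunct2[OF main]])
  ultimately have "(\<forall>X :: real^'m^'n. \<bar>fenchel_conjugate (variational_gram M) X\<bar> \<noteq> \<infinity>) \<longleftrightarrow>
      (\<exists>V\<in>M. invertible V)"
    by (simp only: fin)
  then show ?thesis by (rule conjI[OF allI[OF main]])
qed

end
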